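(* Let $k,n\in\mathbb{N}$ with $k<n$ and let $\mathbf k=(k,\dots,k)\in\mathbb{Z}^n$. Then there is an isomorphism of varieties $$X(k,n)\cong{\rm Gr}_{\mathbf k}(U_{[n]}).$$
   Context: Indices in $\mathbb{Z}_n=\mathbb{Z}/n\mathbb{Z}$ are taken modulo $n$. Let $W$ be an $n$-dimensional complex vector space with basis $e_1,\dots,e_n$; for $i\in\mathbb{Z}_n$ let ${\rm pr}_i(e_j)=e_j$ for $j\ne i$ and ${\rm pr}_i(e_i)=0$. Then $$X(k,n)=\Big\{(V_i)\in\prod_{i\in\mathbb{Z}_n}{\rm Gr}_k(W)\ :\ {\rm pr}_iV_i\subseteq V_{i+1}\ \forall i\in\mathbb{Z}_n\Big\}.$$ $\Delta_n$ is the equioriented cyclic quiver with vertex set $\mathbb{Z}_n$ and arrows $\alpha_i:i\to i+1$. For $i\in\mathbb{Z}_n$, $U(i;n)$ is the complex $\Delta_n$ representation with $U(i;n)^{(j)}=\mathbb{C}$ for all $j$, with $U(i;n)_{\alpha_j}={\rm id}_{\mathbb{C}}$ for $j\ne i$ and $U(i;n)_{\alpha_i}=0$. Set $U_{[n]}=\bigoplus_{i\in\mathbb{Z}_n}U(i;n)$. For a quiver representation $M$ and dimension vector $\mathbf e$, the quiver Grassmannian ${\rm Gr}_{\mathbf e}(M)$ is the variety of all subrepresentations of $M$ of dimension vector $\mathbf e$. *)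

theory Defs
  imports
    "HOL-Analysis.Analysis"
    "HOL-Library.Function_Algebras"
    "Graph_Theory.Digraph"
begin

section \<open>Varieties as spaces with functions\<close>

text \<open>A classical (reduced) complex variety is a topological space together with, for every open
  set \<open>U\<close>, the complex-valued functions that are regular on \<open>U\<close>. Functions are total in HOL;
  membership in \<open>regular S U\<close> depends only on the values on \<open>U\<close> for all spaces below.\<close>

record 'a fspace =
  top_of :: "'a topology"
  regular :: "'a set \<Rightarrow> ('a \<Rightarrow> complex) set"

definition morphism :: "'a fspace \<Rightarrow> 'b fspace \<Rightarrow> ('a \<Rightarrow> 'b) \<Rightarrow> bool" where
  "morphism S T f \<longleftrightarrow> continuous_map (top_of S) (top_of T) f \<and>
     (\<forall>U. openin (top_of T) U \<longrightarrow>
       (\<forall>g \<in> regular T U. g \<circ> f \<in> regular S {x \<in> topspace (top_of S). f x \<in> U}))"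

definition isomorphic :: "'a fspace \<Rightarrow> 'b fspace \<Rightarrow> bool" where
  "isomorphic S T \<longleftrightarrow> (\<exists>f g. morphism S T f \<and> morphism T S g \<and>
     (\<forall>x \<in> topspace (top_of S). g (f x) = x) \<and> (\<forall>y \<in> topspace (top_of T). f (g y) = y))"

text \<open>The induced reduced structure on a subset: the regular functions are those that locally
  extend to regular functions of the ambient space.\<close>

definition subvariety :: "'a fspace \<Rightarrow> 'a set \<Rightarrow> 'a fspace" where
  "subvariety S A =
    \<lparr> top_of = subtopology (top_of S) A,
      regular = (\<lambda>U. {f. openin (subtopology (top_of S) A) U \<and>
        (\<forall>x \<in> U. \<exists>N. openin (top_of S) N \<and> x \<in> N \<and>
          (\<exists>g \<in> regular S N. \<forall>y \<in> N \<inter> U. f y = g y))}) \<rparr>"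


section \<open>Products of Grassmannians\<close>

text \<open>Throughout, \<open>s\<close> is the scalar multiplication of a complex vector space and \<open>E\<close> (or \<open>E i\<close>) is
  a finite-dimensional subspace of it.\<close>

definition Gr :: "(complex \<Rightarrow> 'w \<Rightarrow> 'w) \<Rightarrow> 'w::ab_group_add set \<Rightarrow> nat \<Rightarrow> 'w set set" where
  "Gr s E k = {V. module.subspace s V \<and> V \<subseteq> E \<and> vector_space.dim s V = k}"

definition ordered_basis :: "(complex \<Rightarrow> 'w \<Rightarrow> 'w) \<Rightarrow> 'w::ab_group_add set \<Rightarrow> 'w list \<Rightarrow> bool" where
  "ordered_basis s V vs \<longleftrightarrow>
     distinct vs \<and> \<not> module.dependent s (set vs) \<and> module.span s (set vs) = V"

definition alternating_form ::
    "(complex \<Rightarrow> 'w \<Rightarrow> 'w) \<Rightarrow> 'w::ab_group_add set \<Rightarrow> nat \<Rightarrow> ('w list \<Rightarrow> complex) \<Rightarrow> bool" where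
  "alternating_form s E k \<omega> \<longleftrightarrow>
     (\<forall>vs. length vs = k \<and> set vs \<subseteq> E \<longrightarrow>
        (\<forall>i<k. \<forall>x\<in>E. \<forall>y\<in>E. \<omega> (vs[i := x + y]) = \<omega> (vs[i := x]) + \<omega> (vs[i := y])) \<and>
        (\<forall>i<k. \<forall>c. \<forall>x\<in>E. \<omega> (vs[i := s c x]) = c * \<omega> (vs[i := x])) \<and>
        (\<forall>i<k. \<forall>j<k. i \<noteq> j \<and> vs ! i = vs ! j \<longrightarrow> \<omega> vs = 0))"

text \<open>The Pluecker embedding sends \<open>V\<close> with ordered basis \<open>v1,\<dots>,vk\<close> to the line through
  \<open>v1 \<and> \<dots> \<and> vk\<close> in the \<open>k\<close>-th exterior power of \<open>E\<close>. By the universal property, the linear forms on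
  that exterior power are the alternating \<open>k\<close>-forms \<open>\<omega>\<close> on \<open>E\<close>, and the value at
  \<open>v1 \<and> \<dots> \<and> vk\<close> of the linear form belonging to \<open>\<omega>\<close> is \<open>\<omega> [v1,\<dots>,vk]\<close>. So the values
  \<open>\<omega> [v1,\<dots>,vk]\<close> are the homogeneous Pluecker coordinates of \<open>V\<close>, without choice of a basis of \<open>E\<close>.

  \<open>multihom s I E d \<delta> F\<close>: \<open>F\<close> is a multihomogeneous polynomial of multidegree \<open>\<delta>\<close> in the Pluecker
  coordinates of the factors \<open>Gr s (E i) (d i)\<close>, \<open>i \<in> I\<close>, written as a function of a family of
  ordered bases.\<close>

inductive multihom ::
    "(complex \<Rightarrow> 'w \<Rightarrow> 'w) \<Rightarrow> 'i set \<Rightarrow> ('i \<Rightarrow> 'w::ab_group_add set) \<Rightarrow> ('i \<Rightarrow> nat) \<Rightarrow>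
     ('i \<Rightarrow> nat) \<Rightarrow> (('i \<Rightarrow> 'w list) \<Rightarrow> complex) \<Rightarrow> bool"
  for s I E d where
  const: "multihom s I E d (\<lambda>_. 0) (\<lambda>_. c)"
| coordinate: "i \<in> I \<Longrightarrow> alternating_form s (E i) (d i) \<omega> \<Longrightarrow>
    multihom s I E d (\<lambda>j. if j = i then 1 else 0) (\<lambda>v. \<omega> (v i))"
| add: "multihom s I E d \<delta> F \<Longrightarrow> multihom s I E d \<delta> G \<Longrightarrow> multihom s I E d \<delta> (\<lambda>v. F v + G v)"
| mult: "multihom s I E d \<delta> F \<Longrightarrow> multihom s I E d \<delta>' G \<Longrightarrow>
    multihom s I E d (\<lambda>i. \<delta> i + \<delta>' i) (\<lambda>v. F v * G v)"

definition bases_of ::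
    "(complex \<Rightarrow> 'w \<Rightarrow> 'w) \<Rightarrow> 'i set \<Rightarrow> ('i \<Rightarrow> 'w::ab_group_add set) \<Rightarrow> ('i \<Rightarrow> 'w list) set" where
  "bases_of s I V = {v. \<forall>i\<in>I. ordered_basis s (V i) (v i)}"

definition Gr_points ::
    "(complex \<Rightarrow> 'w \<Rightarrow> 'w) \<Rightarrow> 'i set \<Rightarrow> ('i \<Rightarrow> 'w::ab_group_add set) \<Rightarrow> ('i \<Rightarrow> nat) \<Rightarrow>
     ('i \<Rightarrow> 'w set) set" where
  "Gr_points s I E d = (\<Pi>\<^sub>E i\<in>I. Gr s (E i) (d i))"

text \<open>The Zariski topology of the product of Grassmannians inside the product of projective spaces:
  its base consists of the non-vanishing loci of the multihomogeneous polynomials. Another choice of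
  ordered bases multiplies a multihomogeneous polynomial by a non-zero scalar, so non-vanishing does
  not depend on it.\<close>

definition zariski ::
    "(complex \<Rightarrow> 'w \<Rightarrow> 'w) \<Rightarrow> 'i set \<Rightarrow> ('i \<Rightarrow> 'w::ab_group_add set) \<Rightarrow> ('i \<Rightarrow> nat) \<Rightarrow>
     ('i \<Rightarrow> 'w set) topology" where
  "zariski s I E d = topology_generated_by
     {{V \<in> Gr_points s I E d. \<forall>v \<in> bases_of s I V. F v \<noteq> 0} | \<delta> F. multihom s I E d \<delta> F}"

text \<open>The product of Grassmannians as a closed subvariety of a product of projective spaces: regular
  functions are locally quotients of multihomogeneous polynomials of the same multidegree.\<close>

definition Gr_product ::
    "(complex \<Rightarrow> 'w \<Rightarrow> 'w) \<Rightarrow> 'i set \<Rightarrow> ('i \<Rightarrow> 'w::ab_group_add set) \<Rightarrow> ('i \<Rightarrow> nat) \<Rightarrow>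
     ('i \<Rightarrow> 'w set) fspace" where
  "Gr_product s I E d =
    \<lparr> top_of = zariski s I E d,
      regular = (\<lambda>U. {f. openin (zariski s I E d) U \<and>
        (\<forall>x \<in> U. \<exists>N. openin (zariski s I E d) N \<and> x \<in> N \<and> N \<subseteq> U \<and>
          (\<exists>\<delta> F G. multihom s I E d \<delta> F \<and> multihom s I E d \<delta> G \<and>
            (\<forall>V \<in> N. \<forall>v \<in> bases_of s I V. G v \<noteq> 0 \<and> f V = F v / G v)))}) \<rparr>"


section \<open>The variety \<open>X(k,n)\<close>\<close>

text \<open>The residues modulo \<open>n\<close> are represented by \<open>0,\<dots>,n-1\<close>; in particular \<open>e\<^sub>n\<close> is \<open>e 0\<close>.\<close>

definition cyc :: "nat \<Rightarrow> nat \<Rightarrow> nat" where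
  "cyc n i = Suc i mod n"

definition is_basis :: "(complex \<Rightarrow> 'w \<Rightarrow> 'w) \<Rightarrow> nat \<Rightarrow> (nat \<Rightarrow> 'w::ab_group_add) \<Rightarrow> bool" where
  "is_basis s n e \<longleftrightarrow> inj_on e {..<n} \<and> \<not> module.dependent s (e ` {..<n}) \<and>
     module.span s (e ` {..<n}) = UNIV"

text \<open>\<open>construct\<close> is linear extension from a basis.\<close>

definition pr :: "(complex \<Rightarrow> 'w \<Rightarrow> 'w) \<Rightarrow> nat \<Rightarrow> (nat \<Rightarrow> 'w::ab_group_add) \<Rightarrow> nat \<Rightarrow> 'w \<Rightarrow> 'w" where
  "pr s n e i =
     vector_space_pair.construct s s (e ` {..<n}) (\<lambda>b. if b = e i then 0 else b)"

lemma pr_basis: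
  assumes "vector_space s" "is_basis s n e" "i < n"
  shows "Vector_Spaces.linear s s (pr s n e i)"
    and "j < n \<Longrightarrow> pr s n e i (e j) = (if j = i then 0 else e j)"
proof -
  interpret vector_space_pair s s
    using assms(1) by (simp add: vector_space_pair_def)
  have ind: "\<not> vs1.dependent (e ` {..<n})" and inj: "inj_on e {..<n}"
    using assms(2) by (auto simp: is_basis_def)
  show "Vector_Spaces.linear s s (pr s n e i)"
    unfolding pr_def using linear_construct[OF ind] .
  show "pr s n e i (e j) = (if j = i then 0 else e j)" if "j < n"
    unfolding pr_def using construct_basis[OF ind] that assms(3) inj_onD[OF inj, of j i] by auto
qed

definition X :: "(complex \<Rightarrow> 'w \<Rightarrow> 'w) \<Rightarrow> (nat \<Rightarrow> 'w::ab_group_add) \<Rightarrow> nat \<Rightarrow> nat \<Rightarrow>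
    (nat \<Rightarrow> 'w set) fspace" where
  "X s e k n = subvariety (Gr_product s {..<n} (\<lambda>_. UNIV) (\<lambda>_. k))
     {V \<in> Gr_points s {..<n} (\<lambda>_. UNIV) (\<lambda>_. k). \<forall>i<n. pr s n e i ` V i \<subseteq> V (cyc n i)}"


section \<open>Quiver representations and quiver Grassmannians\<close>

text \<open>A quiver is a \<open>pre_digraph\<close>. The spaces at the vertices are subspaces of one ambient complex
  vector space with scalar multiplication \<open>scl\<close>.\<close>

record ('v, 'a, 'w) rep =
  scl :: "complex \<Rightarrow> 'w \<Rightarrow> 'w"
  sp :: "'v \<Rightarrow> 'w set"
  act :: "'a \<Rightarrow> 'w \<Rightarrow> 'w"

definition representation_of ::
    "('v, 'a) pre_digraph \<Rightarrow> ('v, 'a, 'w::ab_group_add) rep \<Rightarrow> bool" where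
  "representation_of Q M \<longleftrightarrow> vector_space (scl M) \<and>
     (\<forall>v \<in> verts Q. module.subspace (scl M) (sp M v) \<and>
        (\<exists>B. finite B \<and> module.span (scl M) B = sp M v)) \<and>
     (\<forall>a \<in> arcs Q. act M a ` sp M (tail Q a) \<subseteq> sp M (head Q a) \<and>
        (\<forall>x \<in> sp M (tail Q a). \<forall>y \<in> sp M (tail Q a). act M a (x + y) = act M a x + act M a y) \<and>
        (\<forall>c. \<forall>x \<in> sp M (tail Q a). act M a (scl M c x) = scl M c (act M a x)))"

definition subrepresentation ::
    "('v, 'a) pre_digraph \<Rightarrow> ('v, 'a, 'w::ab_group_add) rep \<Rightarrow> ('v \<Rightarrow> 'w set) \<Rightarrow> bool" where
  "subrepresentation Q M N \<longleftrightarrow>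
     (\<forall>v \<in> verts Q. module.subspace (scl M) (N v) \<and> N v \<subseteq> sp M v) \<and>
     (\<forall>a \<in> arcs Q. act M a ` N (tail Q a) \<subseteq> N (head Q a))"

definition quiver_Gr ::
    "('v, 'a) pre_digraph \<Rightarrow> ('v, 'a, 'w::ab_group_add) rep \<Rightarrow> ('v \<Rightarrow> nat) \<Rightarrow>
     ('v \<Rightarrow> 'w set) fspace" where
  "quiver_Gr Q M d = subvariety (Gr_product (scl M) (verts Q) (sp M) d)
     {N \<in> Gr_points (scl M) (verts Q) (sp M) d. subrepresentation Q M N}"

text \<open>The direct sum over a finite index set \<open>K\<close> consists of families that vanish
  outside \<open>K\<close>; \<open>scl (R k)\<close> has to be a scalar multiplication also for \<open>k \<notin> K\<close>, as it acts on
  the whole ambient function space.\<close>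

definition direct_sum ::
    "'k set \<Rightarrow> ('k \<Rightarrow> ('v, 'a, 'w::ab_group_add) rep) \<Rightarrow> ('v, 'a, 'k \<Rightarrow> 'w) rep" where
  "direct_sum K R =
    \<lparr> scl = (\<lambda>c f k. scl (R k) c (f k)),
      sp = (\<lambda>v. {f. (\<forall>k \<in> K. f k \<in> sp (R k) v) \<and> (\<forall>k. k \<notin> K \<longrightarrow> f k = 0)}),
      act = (\<lambda>a f k. if k \<in> K then act (R k) a (f k) else 0) \<rparr>"

text \<open>The arrow \<open>i \<rightarrow> i + 1\<close> is named \<open>i\<close>.\<close>

definition Delta :: "nat \<Rightarrow> (nat, nat) pre_digraph" where
  "Delta n = \<lparr> verts = {..<n}, arcs = {..<n}, tail = (\<lambda>i. i), head = cyc n \<rparr>"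

definition U :: "nat \<Rightarrow> (nat, nat, complex) rep" where
  "U i = \<lparr> scl = (*), sp = (\<lambda>j. UNIV), act = (\<lambda>j. if j = i then (\<lambda>_. 0) else id) \<rparr>"

definition U_sum :: "nat \<Rightarrow> (nat, nat, nat \<Rightarrow> complex) rep" where
  "U_sum n = direct_sum {..<n} U"

lemma wf_Delta: "wf_digraph (Delta n)"
  by unfold_locales (auto simp: Delta_def cyc_def)

lemma representation_U_sum: "representation_of (Delta n) (U_sum n)"
proof -
  interpret vector_space "\<lambda>c (f :: nat \<Rightarrow> complex) k. c * f k"
    by unfold_locales (auto simp: algebra_simps)
  let ?E = "{f :: nat \<Rightarrow> complex. \<forall>k. k \<notin> {..<n} \<longrightarrow> f k = 0}"
  let ?b = "\<lambda>i k. if k = i then 1 else 0 :: complex"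
  have sub: "subspace ?E" by (auto simp: subspace_def)
  have "f \<in> span (?b ` {..<n})" if "f \<in> ?E" for f
  proof -
    have apply_sum: "(\<Sum>i\<in>A. g i) k = (\<Sum>i\<in>A. g i k)" for g :: "nat \<Rightarrow> nat \<Rightarrow> complex" and A k
      by (induction A rule: infinite_finite_induct) auto
    have "f = (\<Sum>i<n. (\<lambda>k. f i * ?b i k))"
      using that by (auto simp: fun_eq_iff apply_sum if_distrib cong: if_cong)
    also have "\<dots> \<in> span (?b ` {..<n})"
      by (intro span_sum span_scale span_base) auto
    finally show ?thesis .
  qed
  moreover have "span (?b ` {..<n}) \<subseteq> ?E"
    by (rule span_minimal[OF _ sub]) auto
  ultimately have "span (?b ` {..<n}) = ?E" by blast
  then have fin: "\<exists>B. finite B \<and> span B = ?E" by (intro exI[of _ "?b ` {..<n}"]) auto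
  show ?thesis
    using sub fin vector_space_axioms
    by (auto simp: representation_of_def U_sum_def direct_sum_def U_def Delta_def fun_eq_iff)
qed

end

theory Submission
  imports Defs
begin

text \<open>The representation \<open>U_sum n\<close> has the same space \<open>\<complex>\<^sup>n\<close> at every vertex, and its arrow \<open>i\<close>
  acts there by killing the \<open>i\<close>-th coordinate. In the coordinates given by \<open>e\<close> this is exactly
  \<open>pr\<^sub>i\<close>. So, once \<open>W\<close> has been identified with \<open>\<complex>\<^sup>n\<close>, both varieties are cut out of
  \<open>\<Prod>\<^sub>i Gr\<^sub>k(\<complex>\<^sup>n)\<close> by the same incidence conditions (\<open>coordinates_pr\<close>).

  The substance of the proof is that a linear isomorphism of the underlying spaces induces an
  isomorphism of products of Grassmannians as spaces with functions (\<open>morphism_transport\<close>).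
  Pulling back an alternating form along a linear map gives an alternating form, hence
  multihomogeneous polynomials in Pluecker coordinates pull back to multihomogeneous polynomials of
  the same multidegree, and the image of an ordered basis of \<open>V\<close> is an ordered basis of the image of
  \<open>V\<close>. Non-vanishing loci and local quotients of polynomials therefore pull back to the same kind of
  objects, and the same applies to the inverse isomorphism. Finally, a morphism of ambient spaces
  restricts to subvarieties (\<open>morphism_subvariety\<close>).\<close>

section \<open>Morphisms of spaces with functions\<close>

lemma morphism_subvariety:
  assumes f: "morphism S T f"
    and AB: "\<And>x. x \<in> topspace (top_of S) \<Longrightarrow> x \<in> A \<Longrightarrow> f x \<in> B"
  shows "morphism (subvariety S A) (subvariety T B) f"
  unfolding morphism_def
proof (intro conjI allI impI ballI)
  have cont: "continuous_map (top_of S) (top_of T) f"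
    using f by (simp add: morphism_def)
  show cont': "continuous_map (top_of (subvariety S A)) (top_of (subvariety T B)) f"
    using cont AB
    by (auto simp: subvariety_def continuous_map_in_subtopology continuous_map_from_subtopology)
  fix U g
  assume U: "openin (top_of (subvariety T B)) U" and g: "g \<in> regular (subvariety T B) U"
  let ?P = "{x \<in> topspace (top_of (subvariety S A)). f x \<in> U}"
  have "\<exists>N. openin (top_of S) N \<and> x \<in> N \<and> (\<exists>h \<in> regular S N. \<forall>y \<in> N \<inter> ?P. (g \<circ> f) y = h y)"
    if x: "x \<in> ?P" for x
  proof -
    from x g obtain N h where N: "openin (top_of T) N" "f x \<in> N" and h: "h \<in> regular T N"
      and eq: "\<forall>y \<in> N \<inter> U. g y = h y"
      by (force simp: subvariety_def)
    let ?N = "{x \<in> topspace (top_of S). f x \<in> N}"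
    have "openin (top_of S) ?N"
      using cont N(1) by (rule openin_continuous_map_preimage)
    moreover have "x \<in> ?N"
      using x N(2) by (auto simp: subvariety_def)
    moreover have "h \<circ> f \<in> regular S ?N"
      using f N(1) h by (auto simp: morphism_def)
    ultimately show ?thesis
      using eq by (intro exI[of _ ?N] conjI bexI[of _ "h \<circ> f"]) auto
  qed
  moreover have "openin (top_of (subvariety S A)) ?P"
    using cont' U by (rule openin_continuous_map_preimage)
  ultimately show "g \<circ> f \<in> regular (subvariety S A) ?P"
    by (simp add: subvariety_def)
qed


section \<open>Images of subspaces under injective linear maps\<close>

lemma ordered_basis_image:
  assumes f: "Vector_Spaces.linear s t f" and inj: "inj_on f V" and vs: "ordered_basis s V vs"
  shows "ordered_basis t (f ` V) (map f vs)"
proof -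
  interpret Vector_Spaces.linear s t f by fact
  have V: "vs1.span (set vs) = V" and "vs1.independent (set vs)" and dist: "distinct vs"
    using vs by (auto simp: ordered_basis_def)
  then have "vs2.independent (f ` set vs)"
    using inj by (intro independent_injective_image) auto
  moreover have "inj_on f (set vs)"
    using inj V vs1.span_superset by (blast intro: inj_on_subset)
  ultimately show ?thesis
    using dist V by (simp add: ordered_basis_def distinct_map span_image)
qed

lemma Gr_image:
  assumes f: "Vector_Spaces.linear s t f" and inj: "inj_on f E" and fE: "f ` E \<subseteq> E'"
    and V: "V \<in> Gr s E k"
  shows "f ` V \<in> Gr t E' k"
proof -
  interpret Vector_Spaces.linear s t f by fact
  have sub: "vs1.subspace V" and VE: "V \<subseteq> E" and dim: "vs1.dim V = k"
    using V by (auto simp: Gr_def)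
  have injV: "inj_on f V" using inj VE by (rule inj_on_subset)
  obtain B where B: "B \<subseteq> V" "vs1.independent B" "V \<subseteq> vs1.span B" "card B = vs1.dim V"
    using vs1.basis_exists by blast
  have span: "vs1.span B = V"
    using B sub vs1.span_minimal by blast
  have "vs2.independent (f ` B)"
    using B(2) injV span by (intro independent_injective_image) auto
  moreover have "vs2.span (f ` B) = vs2.span (f ` V)"
    using span sub by (simp add: span_image vs1.span_eq_iff[THEN iffD2])
  ultimately have "vs2.dim (f ` V) = card (f ` B)"
    by (intro vs2.dim_eq_card)
  also have "\<dots> = card B"
    using injV B(1) by (meson card_image inj_on_subset)
  finally show ?thesis
    using B(4) dim sub VE fE by (auto simp: Gr_def subspace_image)
qed


section \<open>Polynomials in Pluecker coordinates\<close>

lemma alternating_form_comp: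
  assumes f: "Vector_Spaces.linear s t f" and fE: "f ` E \<subseteq> E'"
    and \<omega>: "alternating_form t E' k \<omega>"
  shows "alternating_form s E k (\<lambda>vs. \<omega> (map f vs))"
proof -
  interpret Vector_Spaces.linear s t f by fact
  show ?thesis
    unfolding alternating_form_def
  proof (intro allI impI)
    fix vs assume "length vs = k \<and> set vs \<subseteq> E"
    then have len: "length (map f vs) = k \<and> set (map f vs) \<subseteq> E'" and "length vs = k"
      using fE by auto
    then show "(\<forall>i<k. \<forall>x\<in>E. \<forall>y\<in>E. \<omega> (map f (vs[i := x + y])) =
          \<omega> (map f (vs[i := x])) + \<omega> (map f (vs[i := y]))) \<and>
        (\<forall>i<k. \<forall>c. \<forall>x\<in>E. \<omega> (map f (vs[i := s c x])) = c * \<omega> (map f (vs[i := x]))) \<and>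
        (\<forall>i<k. \<forall>j<k. i \<noteq> j \<and> vs ! i = vs ! j \<longrightarrow> \<omega> (map f vs) = 0)"
      using \<omega>[unfolded alternating_form_def, rule_format, OF len] fE
      by (auto simp: map_update add scale image_subset_iff)
  qed
qed

lemma multihom_comp:
  assumes f: "\<And>i. i \<in> I \<Longrightarrow> Vector_Spaces.linear s t (f i)"
    and fE: "\<And>i. i \<in> I \<Longrightarrow> f i ` E i \<subseteq> E' i"
    and "multihom t I E' d \<delta> F"
  shows "multihom s I E d \<delta> (\<lambda>v. F (\<lambda>i. map (f i) (v i)))"
  using assms(3)
proof induction
  case (coordinate i \<omega>)
  then show ?case
    using alternating_form_comp[OF f fE] by (intro multihom.coordinate)
qed (auto intro: multihom.intros)

lemma multihom_cong:
  assumes "multihom s I E d \<delta> F" and eq: "\<And>i. i \<in> I \<Longrightarrow> v i = w i"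
  shows "F v = F w"
  using assms(1) by induction (auto simp: eq)

lemma topspace_zariski: "topspace (zariski s I E d) = Gr_points s I E d"
proof -
  have "Gr_points s I E d = {V \<in> Gr_points s I E d. \<forall>v \<in> bases_of s I V. (\<lambda>_. 1 :: complex) v \<noteq> 0}"
    by simp
  then show ?thesis
    unfolding zariski_def topology_generated_by_topspace
    using multihom.const[of s I E d 1] by blast
qed


section \<open>Isomorphisms of products of Grassmannians\<close>

text \<open>A family of linear isomorphisms between the subspaces \<open>E i\<close> and \<open>E' i\<close>. Including the inverse
  \<open>\<psi>\<close> makes the data symmetric: every fact about \<open>\<phi>\<close> can be applied to \<open>\<psi>\<close>.\<close>

locale linear_iso_family =
  fixes s :: "complex \<Rightarrow> 'a::ab_group_add \<Rightarrow> 'a" and t :: "complex \<Rightarrow> 'b::ab_group_add \<Rightarrow> 'b"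
    and I :: "'i set" and E :: "'i \<Rightarrow> 'a set" and E' :: "'i \<Rightarrow> 'b set"
    and \<phi> :: "'i \<Rightarrow> 'a \<Rightarrow> 'b" and \<psi> :: "'i \<Rightarrow> 'b \<Rightarrow> 'a"
  assumes linear_\<phi>: "i \<in> I \<Longrightarrow> Vector_Spaces.linear s t (\<phi> i)"
    and linear_\<psi>: "i \<in> I \<Longrightarrow> Vector_Spaces.linear t s (\<psi> i)"
    and \<phi>_image: "i \<in> I \<Longrightarrow> \<phi> i ` E i \<subseteq> E' i"
    and \<psi>_image: "i \<in> I \<Longrightarrow> \<psi> i ` E' i \<subseteq> E i"
    and \<psi>_\<phi>: "i \<in> I \<Longrightarrow> x \<in> E i \<Longrightarrow> \<psi> i (\<phi> i x) = x"
    and \<phi>_\<psi>: "i \<in> I \<Longrightarrow> y \<in> E' i \<Longrightarrow> \<phi> i (\<psi> i y) = y"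
begin

lemma inverse: "linear_iso_family t s I E' E \<psi> \<phi>"
  by (rule linear_iso_family.intro) (fact linear_\<psi> linear_\<phi> \<psi>_image \<phi>_image \<phi>_\<psi> \<psi>_\<phi>)+

definition transport :: "('i \<Rightarrow> 'a set) \<Rightarrow> 'i \<Rightarrow> 'b set" where
  "transport V = (\<lambda>i\<in>I. \<phi> i ` V i)"

lemma inj_on_\<phi>: "i \<in> I \<Longrightarrow> inj_on (\<phi> i) (E i)"
  by (metis \<psi>_\<phi> inj_on_inverseI)

lemma transport_in_Gr_points:
  assumes "V \<in> Gr_points s I E d"
  shows "transport V \<in> Gr_points t I E' d"
  using assms Gr_image[OF linear_\<phi> inj_on_\<phi> \<phi>_image]
  by (auto simp: Gr_points_def transport_def PiE_iff)

lemma map_in_bases_of_transport: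
  assumes V: "V \<in> Gr_points s I E d" and v: "v \<in> bases_of s I V"
  shows "(\<lambda>i. map (\<phi> i) (v i)) \<in> bases_of t I (transport V)"
proof -
  have "inj_on (\<phi> i) (V i)" if "i \<in> I" for i
    using V that inj_on_\<phi>[OF that] by (auto simp: Gr_points_def Gr_def PiE_iff intro: inj_on_subset)
  then show ?thesis
    using v ordered_basis_image[OF linear_\<phi>] by (simp add: bases_of_def transport_def)
qed

interpretation inv: linear_iso_family t s I E' E \<psi> \<phi>
  by (fact inverse)

lemma inverse_transport:
  assumes "V \<in> Gr_points s I E d"
  shows "inv.transport (transport V) = V"
proof
  fix i
  show "inv.transport (transport V) i = V i"
  proof (cases "i \<in> I")
    case True
    then have "V i \<subseteq> E i"
      using assms by (auto simp: Gr_points_def Gr_def PiE_iff)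
    then show ?thesis
      using True \<psi>_\<phi>[OF True] by (force simp: transport_def inv.transport_def image_iff)
  next
    case False
    then show ?thesis
      using assms by (auto simp: transport_def inv.transport_def Gr_points_def PiE_iff extensional_def)
  qed
qed

text \<open>Every family of bases of \<open>transport V\<close> comes from one of \<open>V\<close>, namely from its image under the
  inverse isomorphism. This avoids computing how a polynomial changes with the choice of bases.\<close>

lemma nonvanishing_transport_iff:
  assumes V: "V \<in> Gr_points s I E d" and F: "multihom t I E' d \<delta> F"
  shows "(\<forall>v \<in> bases_of t I (transport V). F v \<noteq> 0) \<longleftrightarrow>
    (\<forall>v \<in> bases_of s I V. F (\<lambda>i. map (\<phi> i) (v i)) \<noteq> 0)"
proof (intro iffI ballI)
  fix w assume *: "\<forall>v \<in> bases_of s I V. F (\<lambda>i. map (\<phi> i) (v i)) \<noteq> 0"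
    and w: "w \<in> bases_of t I (transport V)"
  have V': "transport V \<in> Gr_points t I E' d"
    using V by (rule transport_in_Gr_points)
  have w': "(\<lambda>i. map (\<psi> i) (w i)) \<in> bases_of s I V"
    using inv.map_in_bases_of_transport[OF V' w] inverse_transport[OF V] by simp
  have nz: "F (\<lambda>i. map (\<phi> i) (map (\<psi> i) (w i))) \<noteq> 0"
    using bspec[OF * w'] .
  have "map (\<phi> i) (map (\<psi> i) (w i)) = w i" if i: "i \<in> I" for i
  proof -
    interpret vector_space t
      using linear_\<phi>[OF i] by (simp add: Vector_Spaces.linear_def)
    have "set (w i) \<subseteq> transport V i"
      using i w span_superset[of "set (w i)"] by (simp add: bases_of_def ordered_basis_def)
    also have "\<dots> \<subseteq> E' i"
      using i V' by (simp add: Gr_points_def Gr_def PiE_iff)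
    finally have "set (w i) \<subseteq> E' i" .
    then show ?thesis
      using i by (auto intro!: map_idI simp: \<phi>_\<psi>)
  qed
  then have "F (\<lambda>i. map (\<phi> i) (map (\<psi> i) (w i))) = F w"
    by (rule multihom_cong[OF F])
  with nz show "F w \<noteq> 0"
    by (rule back_subst[where P = "\<lambda>c. c \<noteq> 0"])
next
  fix v assume *: "\<forall>v \<in> bases_of t I (transport V). F v \<noteq> 0" and v: "v \<in> bases_of s I V"
  show "F (\<lambda>i. map (\<phi> i) (v i)) \<noteq> 0"
    using bspec[OF * map_in_bases_of_transport[OF V v]] .
qed

lemma continuous_transport: "continuous_map (zariski s I E d) (zariski t I E' d) transport"
proof -
  let ?B = "{{V \<in> Gr_points t I E' d. \<forall>v \<in> bases_of t I V. F v \<noteq> 0} | \<delta> F. multihom t I E' d \<delta> F}"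
  have "openin (zariski s I E d) (transport -` U \<inter> topspace (zariski s I E d))" if "U \<in> ?B" for U
  proof -
    from that obtain \<delta> F where F: "multihom t I E' d \<delta> F"
      and U: "U = {V \<in> Gr_points t I E' d. \<forall>v \<in> bases_of t I V. F v \<noteq> 0}"
      by blast
    have "transport -` U \<inter> topspace (zariski s I E d) =
        {V \<in> Gr_points s I E d. \<forall>v \<in> bases_of s I V. F (\<lambda>i. map (\<phi> i) (v i)) \<noteq> 0}"
      using nonvanishing_transport_iff[OF _ F] transport_in_Gr_points
      by (auto simp: U topspace_zariski)
    also have "openin (zariski s I E d) \<dots>"
      unfolding zariski_def
    proof (rule topology_generated_by_Basis, rule CollectI, rule exI, rule exI, rule conjI[OF refl])
      show "multihom s I E d \<delta> (\<lambda>v. F (\<lambda>i. map (\<phi> i) (v i)))"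
        using multihom_comp[OF linear_\<phi> \<phi>_image F] .
    qed
    finally show ?thesis .
  qed
  moreover have "transport ` topspace (zariski s I E d) \<subseteq> \<Union>?B"
    using transport_in_Gr_points topspace_zariski[of t I E' d]
    by (auto simp: topspace_zariski zariski_def[of t] topology_generated_by_topspace)
  ultimately show ?thesis
    unfolding zariski_def[of t] continuous_on_generated_topo_iff by blast
qed

lemma morphism_transport: "morphism (Gr_product s I E d) (Gr_product t I E' d) transport"
  unfolding morphism_def
proof (intro conjI allI impI ballI)
  show "continuous_map (top_of (Gr_product s I E d)) (top_of (Gr_product t I E' d)) transport"
    using continuous_transport by (simp add: Gr_product_def)
  fix U g
  assume "openin (top_of (Gr_product t I E' d)) U" and g: "g \<in> regular (Gr_product t I E' d) U"
  then have U: "openin (zariski t I E' d) U"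
    by (simp add: Gr_product_def)
  let ?pre = "\<lambda>U. {V \<in> topspace (zariski s I E d). transport V \<in> U}"
  have local_quot: "\<exists>N. openin (zariski s I E d) N \<and> V \<in> N \<and> N \<subseteq> ?pre U \<and>
      (\<exists>\<delta> F G. multihom s I E d \<delta> F \<and> multihom s I E d \<delta> G \<and>
        (\<forall>V \<in> N. \<forall>v \<in> bases_of s I V. G v \<noteq> 0 \<and> (g \<circ> transport) V = F v / G v))"
    if V: "V \<in> ?pre U" for V
  proof -
    have quotients: "\<forall>V \<in> U. \<exists>N. openin (zariski t I E' d) N \<and> V \<in> N \<and> N \<subseteq> U \<and>
        (\<exists>\<delta> F G. multihom t I E' d \<delta> F \<and> multihom t I E' d \<delta> G \<and>
          (\<forall>V \<in> N. \<forall>v \<in> bases_of t I V. G v \<noteq> 0 \<and> g V = F v / G v))"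
      using g unfolding Gr_product_def fspace.select_convs mem_Collect_eq by (rule conjunct2)
    have "transport V \<in> U"
      using V by simp
    from bspec[OF quotients this] obtain N \<delta> F G
      where N: "openin (zariski t I E' d) N" "transport V \<in> N" "N \<subseteq> U"
      and F: "multihom t I E' d \<delta> F" and G: "multihom t I E' d \<delta> G"
      and quot: "\<forall>V \<in> N. \<forall>v \<in> bases_of t I V. G v \<noteq> 0 \<and> g V = F v / G v"
      by (elim exE conjE) (rule that)
    have preN: "openin (zariski s I E d) (?pre N)"
      using continuous_transport N(1) by (rule openin_continuous_map_preimage)
    have V_pre: "V \<in> ?pre N" and pre_mono: "?pre N \<subseteq> ?pre U"
      using V N by auto
    have quot': "\<exists>\<delta> F G. multihom s I E d \<delta> F \<and> multihom s I E d \<delta> G \<and>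
        (\<forall>V \<in> ?pre N. \<forall>v \<in> bases_of s I V. G v \<noteq> 0 \<and> (g \<circ> transport) V = F v / G v)"
    proof (rule exI[of _ \<delta>], rule exI[of _ "\<lambda>v. F (\<lambda>i. map (\<phi> i) (v i))"],
        rule exI[of _ "\<lambda>v. G (\<lambda>i. map (\<phi> i) (v i))"], intro conjI)
      show "multihom s I E d \<delta> (\<lambda>v. F (\<lambda>i. map (\<phi> i) (v i)))"
        using multihom_comp[OF linear_\<phi> \<phi>_image F] .
      show "multihom s I E d \<delta> (\<lambda>v. G (\<lambda>i. map (\<phi> i) (v i)))"
        using multihom_comp[OF linear_\<phi> \<phi>_image G] .
      show "\<forall>V \<in> ?pre N. \<forall>v \<in> bases_of s I V. G (\<lambda>i. map (\<phi> i) (v i)) \<noteq> 0 \<and>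
          (g \<circ> transport) V = F (\<lambda>i. map (\<phi> i) (v i)) / G (\<lambda>i. map (\<phi> i) (v i))"
      proof (intro ballI)
        fix V v assume V: "V \<in> ?pre N" and v: "v \<in> bases_of s I V"
        then have V': "transport V \<in> N" and v': "(\<lambda>i. map (\<phi> i) (v i)) \<in> bases_of t I (transport V)"
          using map_in_bases_of_transport[of V d v] by (simp_all add: topspace_zariski)
        show "G (\<lambda>i. map (\<phi> i) (v i)) \<noteq> 0 \<and>
            (g \<circ> transport) V = F (\<lambda>i. map (\<phi> i) (v i)) / G (\<lambda>i. map (\<phi> i) (v i))"
          unfolding comp_apply using bspec[OF bspec[OF quot V'] v'] .
      qed
    qed
    show ?thesis
      by (rule exI[of _ "?pre N"], rule conjI[OF preN conjI[OF V_pre conjI[OF pre_mono quot']]])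
  qed
  have "openin (zariski s I E d) (?pre U)"
    using continuous_transport U by (rule openin_continuous_map_preimage)
  then have "g \<circ> transport \<in> regular (Gr_product s I E d) (?pre U)"
    unfolding Gr_product_def fspace.select_convs mem_Collect_eq
    by (intro conjI ballI local_quot)
  then show "g \<circ> transport \<in>
      regular (Gr_product s I E d) {V \<in> topspace (top_of (Gr_product s I E d)). transport V \<in> U}"
    by (simp add: Gr_product_def)
qed

end

lemma (in linear_iso_family) isomorphic_subvarieties:
  assumes AB: "\<And>V. V \<in> Gr_points s I E d \<Longrightarrow> V \<in> A \<Longrightarrow> transport V \<in> B"
    and BA: "\<And>N. N \<in> Gr_points t I E' d \<Longrightarrow> N \<in> B \<Longrightarrow> (\<lambda>i\<in>I. \<psi> i ` N i) \<in> A"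
  shows "isomorphic (subvariety (Gr_product s I E d) A) (subvariety (Gr_product t I E' d) B)"
proof -
  interpret inv: linear_iso_family t s I E' E \<psi> \<phi>
    by (fact inverse)
  have top: "topspace (top_of (Gr_product s I E d)) = Gr_points s I E d"
    "topspace (top_of (Gr_product t I E' d)) = Gr_points t I E' d"
    by (simp_all add: Gr_product_def topspace_zariski)
  show ?thesis
    unfolding isomorphic_def
  proof (intro exI conjI ballI)
    show "morphism (subvariety (Gr_product s I E d) A) (subvariety (Gr_product t I E' d) B) transport"
      using morphism_transport by (rule morphism_subvariety) (use AB in \<open>simp add: top\<close>)
    show "morphism (subvariety (Gr_product t I E' d) B) (subvariety (Gr_product s I E d) A) inv.transport"
      using inv.morphism_transport
      by (rule morphism_subvariety) (use BA in \<open>simp add: top inv.transport_def\<close>)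
    show "inv.transport (transport V) = V"
      if "V \<in> topspace (top_of (subvariety (Gr_product s I E d) A))" for V
      using that inverse_transport by (auto simp: subvariety_def top)
    show "transport (inv.transport N) = N"
      if "N \<in> topspace (top_of (subvariety (Gr_product t I E' d) B))" for N
      using that inv.inverse_transport by (auto simp: subvariety_def top)
  qed
qed


section \<open>Coordinates with respect to a basis\<close>

abbreviation pointwise_scale :: "complex \<Rightarrow> (nat \<Rightarrow> complex) \<Rightarrow> nat \<Rightarrow> complex" where
  "pointwise_scale \<equiv> (\<lambda>c f k. c * f k)"

definition coordinates :: "(complex \<Rightarrow> 'w \<Rightarrow> 'w) \<Rightarrow> nat \<Rightarrow> (nat \<Rightarrow> 'w::ab_group_add) \<Rightarrow> 'w \<Rightarrow> nat \<Rightarrow> complex"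
  where "coordinates s n e w = (\<lambda>j. if j < n then module.representation s (e ` {..<n}) w (e j) else 0)"

definition combination :: "(complex \<Rightarrow> 'w \<Rightarrow> 'w) \<Rightarrow> nat \<Rightarrow> (nat \<Rightarrow> 'w::ab_group_add) \<Rightarrow> (nat \<Rightarrow> complex) \<Rightarrow> 'w"
  where "combination s n e f = (\<Sum>j<n. s (f j) (e j))"

lemma coordinates_iso:
  fixes s :: "complex \<Rightarrow> 'w::ab_group_add \<Rightarrow> 'w"
  assumes s: "vector_space s" and e: "is_basis s n e"
  shows "linear_iso_family s pointwise_scale I (\<lambda>_. UNIV) (\<lambda>_. {f. \<forall>j\<ge>n. f j = 0})
    (\<lambda>_. coordinates s n e) (\<lambda>_. combination s n e)"
proof -
  interpret vector_space s by fact
  have ind: "independent (e ` {..<n})" and inj: "inj_on e {..<n}" and span: "span (e ` {..<n}) = UNIV"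
    using e by (auto simp: is_basis_def)
  have pointwise: "vector_space pointwise_scale"
    by unfold_locales (auto simp: algebra_simps)
  show ?thesis
  proof (rule linear_iso_family.intro)
    show "Vector_Spaces.linear s pointwise_scale (coordinates s n e)"
      using s pointwise ind span
      by (auto simp: Vector_Spaces.linear_iff coordinates_def representation_add representation_scale)
    show "Vector_Spaces.linear pointwise_scale s (combination s n e)"
      using s pointwise
      by (auto simp: Vector_Spaces.linear_iff combination_def scale_left_distrib sum.distrib scale_sum_right)
    show "coordinates s n e ` UNIV \<subseteq> {f. \<forall>j\<ge>n. f j = 0}"
      by (auto simp: coordinates_def)
    show "combination s n e (coordinates s n e x) = x" for x
    proof -
      have "combination s n e (coordinates s n e x) =
          (\<Sum>b\<in>e ` {..<n}. s (representation (e ` {..<n}) x b) b)"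
        using inj by (simp add: combination_def coordinates_def sum.reindex)
      also have "\<dots> = x"
        using ind span by (intro sum_representation_eq) auto
      finally show ?thesis .
    qed
    show "coordinates s n e (combination s n e f) = f" if "f \<in> {f. \<forall>j\<ge>n. f j = 0}" for f
    proof
      fix j
      have "representation (e ` {..<n}) (combination s n e f) (e j) = f j" if j: "j < n"
      proof -
        have "representation (e ` {..<n}) (combination s n e f) (e j) =
            (\<Sum>i<n. f i * representation (e ` {..<n}) (e i) (e j))"
          using ind span
          by (simp add: combination_def representation_sum representation_scale)
        also have "\<dots> = (\<Sum>i<n. if i = j then f i else 0)"
          using j ind inj_onD[OF inj, of _ j]
          by (intro sum.cong) (auto simp: representation_basis)
        finally show ?thesis using j by simp
      qed
      then show "coordinates s n e (combination s n e f) j = f j"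
        using that by (auto simp: coordinates_def)
    qed
  qed auto
qed

lemma combination_act:
  fixes s :: "complex \<Rightarrow> 'w::ab_group_add \<Rightarrow> 'w"
  assumes s: "vector_space s" and e: "is_basis s n e" and i: "i < n"
  shows "combination s n e (act (U_sum n) i f) = pr s n e i (combination s n e f)"
proof -
  interpret pr: Vector_Spaces.linear s s "pr s n e i"
    using pr_basis(1)[OF s e i] .
  show ?thesis
    by (auto simp: combination_def pr.sum pr.scale pr_basis(2)[OF s e i] U_sum_def direct_sum_def
        U_def intro!: sum.cong)
qed

lemma coordinates_pr:
  fixes s :: "complex \<Rightarrow> 'w::ab_group_add \<Rightarrow> 'w"
  assumes s: "vector_space s" and e: "is_basis s n e" and i: "i < n"
  shows "coordinates s n e (pr s n e i w) = act (U_sum n) i (coordinates s n e w)"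
proof -
  interpret linear_iso_family s pointwise_scale UNIV "\<lambda>_. UNIV" "\<lambda>_. {f. \<forall>j\<ge>n. f j = 0}"
    "\<lambda>_. coordinates s n e" "\<lambda>_. combination s n e"
    using s e by (rule coordinates_iso)
  have "pr s n e i w = combination s n e (act (U_sum n) i (coordinates s n e w))"
    using \<psi>_\<phi> by (simp add: combination_act[OF s e i])
  then show ?thesis
    using \<phi>_\<psi> by (simp add: U_sum_def direct_sum_def)
qed

theorem proposition3p1:
  fixes s :: "complex \<Rightarrow> 'w::ab_group_add \<Rightarrow> 'w"
    and e :: "nat \<Rightarrow> 'w"
    and k n :: nat
  assumes "vector_space s"
    and "is_basis s n e"
    and "k < n"
  shows "isomorphic (X s e k n) (quiver_Gr (Delta n) (U_sum n) (\<lambda>_. k))"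
proof -
  let ?E = "\<lambda>_ :: nat. {f :: nat \<Rightarrow> complex. \<forall>j\<ge>n. f j = 0}"
  interpret linear_iso_family s pointwise_scale "{..<n}" "\<lambda>_. UNIV" ?E
    "\<lambda>_. coordinates s n e" "\<lambda>_. combination s n e"
    using assms(1,2) by (rule coordinates_iso)
  interpret inv: linear_iso_family pointwise_scale s "{..<n}" ?E "\<lambda>_. UNIV"
    "\<lambda>_. combination s n e" "\<lambda>_. coordinates s n e"
    by (fact inverse)
  have cyc: "cyc n i < n" if "i < n" for i
    using that by (simp add: cyc_def)
  have rep: "scl (U_sum n) = pointwise_scale" "sp (U_sum n) = ?E"
    by (auto simp: U_sum_def direct_sum_def U_def not_less fun_eq_iff)
  have Delta: "verts (Delta n) = {..<n}" "arcs (Delta n) = {..<n}" "tail (Delta n) = (\<lambda>i. i)"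
    "head (Delta n) = cyc n"
    by (simp_all add: Delta_def)
  \<comment> \<open>Points of the product already consist of subspaces, so only the arrows impose conditions.\<close>
  have sub: "subrepresentation (Delta n) (U_sum n) N \<longleftrightarrow>
      (\<forall>i<n. act (U_sum n) i ` N i \<subseteq> N (cyc n i))"
    if "N \<in> Gr_points pointwise_scale {..<n} ?E (\<lambda>_. k)" for N
    using that
    by (auto simp: subrepresentation_def Delta rep Gr_points_def Gr_def PiE_iff image_subset_iff)
  show ?thesis
    unfolding X_def quiver_Gr_def rep Delta
  proof (rule isomorphic_subvarieties)
    fix V assume V: "V \<in> Gr_points s {..<n} (\<lambda>_. UNIV) (\<lambda>_. k)"
      and "V \<in> {V \<in> Gr_points s {..<n} (\<lambda>_. UNIV) (\<lambda>_. k). \<forall>i<n. pr s n e i ` V i \<subseteq> V (cyc n i)}"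
    then have X: "pr s n e i x \<in> V (cyc n i)" if "i < n" "x \<in> V i" for i x
      using that by blast
    have "\<forall>i<n. act (U_sum n) i ` transport V i \<subseteq> transport V (cyc n i)"
    proof (clarsimp simp: transport_def cyc)
      fix i x assume "i < n" "x \<in> V i"
      then show "act (U_sum n) i (coordinates s n e x) \<in> coordinates s n e ` V (cyc n i)"
        using X[of i x] coordinates_pr[OF assms(1,2), of i x] by (metis imageI)
    qed
    then show "transport V \<in> {N \<in> Gr_points pointwise_scale {..<n} ?E (\<lambda>_. k).
        subrepresentation (Delta n) (U_sum n) N}"
      using sub transport_in_Gr_points[OF V] by blast
  next
    fix N assume N: "N \<in> Gr_points pointwise_scale {..<n} ?E (\<lambda>_. k)"
      and "N \<in> {N \<in> Gr_points pointwise_scale {..<n} ?E (\<lambda>_. k).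
        subrepresentation (Delta n) (U_sum n) N}"
    then have Y: "act (U_sum n) i f \<in> N (cyc n i)" if "i < n" "f \<in> N i" for i f
      using that sub by blast
    have "\<forall>i<n. pr s n e i ` inv.transport N i \<subseteq> inv.transport N (cyc n i)"
    proof (clarsimp simp: inv.transport_def cyc)
      fix i f assume "i < n" "f \<in> N i"
      then show "pr s n e i (combination s n e f) \<in> combination s n e ` N (cyc n i)"
        using Y[of i f] combination_act[OF assms(1,2), of i f] by (metis imageI)
    qed
    then show "(\<lambda>i\<in>{..<n}. combination s n e ` N i) \<in>
        {V \<in> Gr_points s {..<n} (\<lambda>_. UNIV) (\<lambda>_. k). \<forall>i<n. pr s n e i ` V i \<subseteq> V (cyc n i)}"
      using inv.transport_in_Gr_points[OF N] by (simp add: inv.transport_def)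
  qed
qed

end
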